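(* Let $R$ be an associative ring with unit element $1$. Let $M$ be the colimit, in the category of groups, of the infinite diagram consisting of the groups $\mathrm{GL}(n,R)$ for $n \geq 3$ together with, for each $n \geq 3$, the two group homomorphisms $$i^n_1,\ i^n_{n+1} \colon \mathrm{GL}(n,R) \longrightarrow \mathrm{GL}(n+1,R), \qquad i^n_1(A) = \begin{pmatrix} 1 & 0 \\ 0 & A \end{pmatrix}, \quad i^n_{n+1}(A) = \begin{pmatrix} A & 0 \\ 0 & 1 \end{pmatrix}.$$ Then the group $M$ is canonically isomorphic to $K_1(R)$.
   Context: $\mathrm{GL}(n,R)$ is the group of invertible $n \times n$ matrices with entries in $R$ (not assumed commutative). The colimit $M$ is the universal group equipped with homomorphisms $\alpha_n \colon \mathrm{GL}(n,R) \to M$, $n \geq 3$, satisfying $\alpha_{n+1} \circ i^n_1 = \alpha_n$ and $\alpha_{n+1} \circ i^n_{n+1} = \alpha_n$ for all $n \geq 3$. The stable general linear group is $\mathrm{GL}(R) = \bigcup_{n \geq 3} \mathrm{GL}(n,R)$, i.e. the colimit of the sequence $\mathrm{GL}(3,R) \to \mathrm{GL}(4,R) \to \mathrm{GL}(5,R) \to \cdots$ along the maps $i^n_{n+1}$ only. $E(n,R) \subseteq \mathrm{GL}(n,R)$ is the subgroup generated by the elementary matrices (those which differ from the identity matrix in at most one off-diagonal entry), and $E(R) = \bigcup_{n \geq 3} E(n,R) \subseteq \mathrm{GL}(R)$, the union being formed via the maps $i^n_{n+1}$. The subgroup $E(R)$ is normal in $\mathrm{GL}(R)$, and $K_1(R)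 = \mathrm{GL}(R)/E(R)$ is the algebraic $K$-group of $R$. *)

theory Defs
  imports
    "Jordan_Normal_Form.Matrix"
    "HOL-Algebra.Coset"
    "HOL-Algebra.Generated_Groups"
begin

text \<open>
  The coefficient ring is a type of sort \<open>{ring, monoid_mult}\<close>: an associative ring with unit,
  not assumed commutative. Unlike \<open>ring_1\<close>, this sort does not exclude the zero ring. (For the same
  reason \<open>ring_mat\<close>, which needs \<open>semiring_1\<close>, is not used for the monoid of square matrices.)
\<close>

subsection \<open>General linear groups and stabilization\<close>

definition square_mat_monoid :: "nat \<Rightarrow> 'a::{ring, monoid_mult} mat monoid" where
  "square_mat_monoid n = \<lparr>carrier = carrier_mat n n, mult = (*), one = 1\<^sub>m n\<rparr>"

definition GL :: "nat \<Rightarrow> 'a::{ring, monoid_mult} mat monoid" where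
  "GL n = units_of (square_mat_monoid n)"

definition stab_first :: "nat \<Rightarrow> 'a::{ring, monoid_mult} mat \<Rightarrow> 'a mat" where
  "stab_first n A = four_block_mat (1\<^sub>m 1) (0\<^sub>m 1 n) (0\<^sub>m n 1) A"

definition stab_last :: "nat \<Rightarrow> 'a::{ring, monoid_mult} mat \<Rightarrow> 'a mat" where
  "stab_last n A = four_block_mat A (0\<^sub>m n 1) (0\<^sub>m 1 n) (1\<^sub>m 1)"

definition elementary_mats :: "nat \<Rightarrow> 'a::{ring, monoid_mult} mat set" where
  "elementary_mats n = {A \<in> carrier_mat n n.
     \<exists>i<n. \<exists>j<n. i \<noteq> j \<and> (\<forall>k<n. \<forall>l<n. (k, l) \<noteq> (i, j) \<longrightarrow> A $$ (k, l) = 1\<^sub>m n $$ (k, l))}"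

definition E :: "nat \<Rightarrow> 'a::{ring, monoid_mult} mat set" where
  "E n = generate (GL n) (elementary_mats n)"


subsection \<open>The stable groups and \<open>K\<^sub>1\<close>\<close>

text \<open>
  The colimit of the groups \<open>GL n\<close> along the maps \<open>stab_last\<close> is realized as an actual union: an
  \<open>n \<times> n\<close> matrix is identified with the infinite matrix obtained by continuing it with the
  identity. This identification is injective, compatible with \<open>stab_last\<close> and multiplicative, see
  the lemmas below.
\<close>

definition to_stable :: "nat \<Rightarrow> 'a::{ring, monoid_mult} mat \<Rightarrow> nat \<Rightarrow> nat \<Rightarrow> 'a" where
  "to_stable n A = (\<lambda>i j. if i < n \<and> j < n then A $$ (i, j) else if i = j then 1 else 0)"

text \<open>All rows of the matrices in question have finite support, so the sums are finite.\<close>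

definition GL_stable :: "(nat \<Rightarrow> nat \<Rightarrow> 'a::{ring, monoid_mult}) monoid" where
  "GL_stable = \<lparr>carrier = (\<Union>n\<in>{3..}. to_stable n ` carrier (GL n)),
                mult = (\<lambda>f g i j. \<Sum>k | f i k \<noteq> 0. f i k * g k j),
                one = (\<lambda>i j. if i = j then 1 else 0)\<rparr>"

definition E_stable :: "(nat \<Rightarrow> nat \<Rightarrow> 'a::{ring, monoid_mult}) set" where
  "E_stable = (\<Union>n\<in>{3..}. to_stable n ` E n)"

definition K1 :: "(nat \<Rightarrow> nat \<Rightarrow> 'a::{ring, monoid_mult}) set monoid" where
  "K1 = GL_stable Mod E_stable"

definition to_K1 :: "nat \<Rightarrow> 'a::{ring, monoid_mult} mat \<Rightarrow> (nat \<Rightarrow> nat \<Rightarrow> 'a) set" where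
  "to_K1 n A = E_stable #>\<^bsub>GL_stable\<^esub> to_stable n A"


subsection \<open>Colimits of the diagram with both stabilization maps\<close>

definition GL_cocone :: "'m monoid \<Rightarrow> (nat \<Rightarrow> 'a::{ring, monoid_mult} mat \<Rightarrow> 'm) \<Rightarrow> bool" where
  "GL_cocone M \<alpha> \<longleftrightarrow> group M \<and>
     (\<forall>n\<ge>3. \<alpha> n \<in> hom (GL n) M) \<and>
     (\<forall>n\<ge>3. \<forall>A\<in>carrier (GL n). \<alpha> (Suc n) (stab_first n A) = \<alpha> n A) \<and>
     (\<forall>n\<ge>3. \<forall>A\<in>carrier (GL n). \<alpha> (Suc n) (stab_last n A) = \<alpha> n A)"

text \<open>
  A type cannot be quantified inside a formula, so the type \<open>'h\<close> of the elements of the groups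
  against which the universal property is tested is a parameter. Members of \<open>hom\<close> are arbitrary
  outside the carrier; \<open>extensional\<close> makes uniqueness refer to the carrier only.
\<close>

definition GL_colimit ::
    "'h itself \<Rightarrow> 'm monoid \<Rightarrow> (nat \<Rightarrow> 'a::{ring, monoid_mult} mat \<Rightarrow> 'm) \<Rightarrow> bool" where
  "GL_colimit ty M \<alpha> \<longleftrightarrow> GL_cocone M \<alpha> \<and>
     (\<forall>(H :: 'h monoid) \<beta>. GL_cocone H \<beta> \<longrightarrow>
        (\<exists>!h. h \<in> hom M H \<and> h \<in> extensional (carrier M) \<and>
              (\<forall>n\<ge>3. \<forall>A\<in>carrier (GL n). h (\<alpha> n A) = \<beta> n A)))"


subsection \<open>The maps \<open>to_stable\<close> identify \<open>GL n\<close> with a part of \<open>GL_stable\<close>\<close>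

lemma mult_one_mat:
  fixes A :: "'a::{ring, monoid_mult} mat"
  assumes "A \<in> carrier_mat n n"
  shows "1\<^sub>m n * A = A" and "A * 1\<^sub>m n = A"
proof -
  have "(\<Sum>k = 0..<n. (if i = k then 1 else 0) * A $$ (k, j)) = A $$ (i, j)" if "i < n" for i j
    using that by (subst sum.remove[of _ i]) (auto intro!: sum.neutral)
  then show "1\<^sub>m n * A = A"
    using assms by (intro eq_matI) (auto simp: scalar_prod_def)
  have "(\<Sum>k = 0..<n. A $$ (i, k) * (if k = j then 1 else 0)) = A $$ (i, j)" if "j < n" for i j
    using that by (subst sum.remove[of _ j]) (auto intro!: sum.neutral)
  then show "A * 1\<^sub>m n = A"
    using assms by (intro eq_matI) (auto simp: scalar_prod_def)
qed

lemma monoid_square_mat_monoid: "monoid (square_mat_monoid n)"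
  by (unfold_locales) (auto simp: square_mat_monoid_def mult_one_mat)

lemma group_GL: "group (GL n)"
  unfolding GL_def by (rule monoid.units_group[OF monoid_square_mat_monoid])

lemma carrier_GL:
  "carrier (GL n) = {A \<in> carrier_mat n n. \<exists>B\<in>carrier_mat n n. B * A = 1\<^sub>m n \<and> A * B = 1\<^sub>m n}"
  by (auto simp: GL_def units_of_def Units_def square_mat_monoid_def)

lemma mult_GL [simp]: "A \<otimes>\<^bsub>GL n\<^esub> B = A * B"
  by (simp add: GL_def units_of_def square_mat_monoid_def)

lemma inj_on_to_stable: "inj_on (to_stable n) (carrier (GL n))"
proof (rule inj_onI)
  fix A B :: "'a mat"
  assume "A \<in> carrier (GL n)" "B \<in> carrier (GL n)" and eq: "to_stable n A = to_stable n B"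
  then have "A \<in> carrier_mat n n" "B \<in> carrier_mat n n" by (auto simp: carrier_GL)
  moreover have "A $$ (i, j) = B $$ (i, j)" if "i < n" "j < n" for i j
    using fun_cong[OF fun_cong[OF eq, of i], of j] that by (simp add: to_stable_def)
  ultimately show "A = B" by (intro eq_matI) auto
qed

lemma to_stable_stab_last:
  "A \<in> carrier_mat n n \<Longrightarrow> to_stable (Suc n) (stab_last n A) = to_stable n A"
  by (intro ext) (auto simp: to_stable_def stab_last_def less_Suc_eq)

lemma to_stable_mult:
  fixes A B :: "'a::{ring, monoid_mult} mat"
  assumes A: "A \<in> carrier_mat n n" and B: "B \<in> carrier_mat n n"
  shows "to_stable n (A * B) = to_stable n A \<otimes>\<^bsub>GL_stable\<^esub> to_stable n B"
proof (intro ext)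
  fix i j
  let ?f = "to_stable n A" and ?g = "to_stable n B"
  have "(\<Sum>k | ?f i k \<noteq> 0. ?f i k * ?g k j) = to_stable n (A * B) i j"
  proof (cases "i < n")
    case True
    have "(\<Sum>k | ?f i k \<noteq> 0. ?f i k * ?g k j) = (\<Sum>k = 0..<n. ?f i k * ?g k j)"
      using True by (intro sum.mono_neutral_left) (auto simp: to_stable_def split: if_splits)
    also have "\<dots> = to_stable n (A * B) i j"
      using True A B by (auto simp: to_stable_def scalar_prod_def intro!: sum.neutral)
    finally show ?thesis .
  next
    case False
    have "(\<Sum>k | ?f i k \<noteq> 0. ?f i k * ?g k j) = (\<Sum>k\<in>{i}. ?f i k * ?g k j)"
      using False by (intro sum.mono_neutral_left) (auto simp: to_stable_def split: if_splits)
    then show ?thesis using False by (simp add: to_stable_def)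
  qed
  then show "to_stable n (A * B) i j = (?f \<otimes>\<^bsub>GL_stable\<^esub> ?g) i j"
    by (simp add: GL_stable_def)
qed

end

theory Submission
  imports Defs
begin

text \<open>
  In a cocone \<open>\<beta>\<close> the matrices \<open>A\<close>, \<open>diag(A, 1)\<close> and \<open>diag(1, A)\<close> have the same image. Since
  \<open>diag(A, 1)\<close> and \<open>diag(1, B)\<close> commute, the image of \<open>\<beta>\<close> is abelian, so \<open>\<beta>\<close> kills every elementary
  matrix, which is a commutator as \<open>n \<ge> 3\<close>; hence \<open>\<beta>\<close> factors through \<open>K\<^sub>1\<close>. Conversely, \<open>diag(A, A\<inverse>)\<close>
  is a product of elementary matrices (Whitehead), so \<open>E(R)\<close> contains all commutators of \<open>GL(R)\<close>
  and \<open>K\<^sub>1\<close> is abelian; therefore \<open>diag(A, 1)\<close> and \<open>diag(1, A)\<close>, being conjugate, agree in it.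
\<close>

section \<open>Elementary matrices\<close>

text \<open>For distinct \<open>i\<close> and \<open>j\<close> this is the elementary matrix
  e_ij(a). Writing each entry as a sum lets a matrix product split into two sums with a single
  surviving term each.\<close>

definition transvection :: "nat \<Rightarrow> nat \<Rightarrow> nat \<Rightarrow> 'a::{ring, monoid_mult} \<Rightarrow> 'a mat" where
  "transvection n i j a =
     mat n n (\<lambda>(k, l). (if k = l then 1 else 0) + (if k = i \<and> l = j then a else 0))"

lemma transvection_carrier [simp]: "transvection n i j a \<in> carrier_mat n n"
  by (simp add: transvection_def)

text \<open>Left multiplication by e_ij(a) is the row operation that adds \<open>a\<close> times row
  \<open>j\<close> to row \<open>i\<close>. All later products with transvections are evaluated
  entrywise through this formula.\<close>

lemma transvection_mult:
  fixes X :: "'a::{ring, monoid_mult} mat"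
  assumes "i < n" "j < n" "X \<in> carrier_mat n m"
  shows "transvection n i j a * X =
    mat n m (\<lambda>(k, l). X $$ (k, l) + (if k = i then a * X $$ (j, l) else 0))"
proof (intro eq_matI)
  fix k l
  assume "k < dim_row (mat n m (\<lambda>(k, l). X $$ (k, l) + (if k = i then a * X $$ (j, l) else 0)))"
    and "l < dim_col (mat n m (\<lambda>(k, l). X $$ (k, l) + (if k = i then a * X $$ (j, l) else 0)))"
  then have kl: "k < n" "l < m" by auto
  have "(transvection n i j a * X) $$ (k, l) =
      (\<Sum>r = 0..<n. (if k = r then X $$ (r, l) else 0) +
        (if r = j then (if k = i then a * X $$ (r, l) else 0) else 0))"
    using kl assms
    by (auto simp: transvection_def scalar_prod_def distrib_right intro!: sum.cong)
  also have "\<dots> = X $$ (k, l) + (if k = i then a * X $$ (j, l) else 0)"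
    using kl assms by (simp add: sum.distrib)
  finally show "(transvection n i j a * X) $$ (k, l) =
      mat n m (\<lambda>(k, l). X $$ (k, l) + (if k = i then a * X $$ (j, l) else 0)) $$ (k, l)"
    using kl by simp
qed (use assms in \<open>auto simp: transvection_def\<close>)

lemma transvection_mult_transvection:
  assumes "i < n" "j < n" "i \<noteq> j"
  shows "transvection n i j a * transvection n i j b = transvection n i j (a + b)"
  using assms
  by (subst transvection_mult[of _ _ _ _ n]) (auto simp: transvection_def algebra_simps)

lemma transvection_0: "transvection n i j 0 = 1\<^sub>m n"
  by (intro eq_matI) (auto simp: transvection_def)

lemma transvection_in_GL:
  assumes "i < n" "j < n" "i \<noteq> j"
  shows "transvection n i j a \<in> carrier (GL n)"
  using assms
  by (auto simp: carrier_GL transvection_mult_transvection transvection_0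
      intro!: bexI[of _ "transvection n i j (- a)"])

text \<open>This is the Steinberg relation [e_ik(a), e_kj(b)] = e_ij(ab), arranged as XY = C(YX) so
  that no inverses occur.\<close>

lemma transvection_commutator:
  assumes "i < n" "j < n" "k < n" "i \<noteq> j" "i \<noteq> k" "j \<noteq> k"
  shows "transvection n i k a * transvection n k j b =
    transvection n i j (a * b) * (transvection n k j b * transvection n i k a)"
  using assms
  by (subst (1 2 3) transvection_mult[of _ _ _ _ n])
     (auto simp: transvection_def intro!: eq_matI)

lemma elementary_mats_eq:
  "elementary_mats n = {transvection n i j a | i j a. i < n \<and> j < n \<and> i \<noteq> j}"
proof (intro equalityI subsetI)
  fix A :: "'a mat" assume "A \<in> elementary_mats n"
  then obtain i j where ij: "A \<in> carrier_mat n n" "i < n" "j < n" "i \<noteq> j"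
    "\<And>k l. k < n \<Longrightarrow> l < n \<Longrightarrow> (k, l) \<noteq> (i, j) \<Longrightarrow> A $$ (k, l) = 1\<^sub>m n $$ (k, l)"
    unfolding elementary_mats_def by blast
  then have "A = transvection n i j (A $$ (i, j))"
    by (intro eq_matI) (auto simp: transvection_def)
  then show "A \<in> {transvection n i j a | i j a. i < n \<and> j < n \<and> i \<noteq> j}"
    using ij by blast
next
  fix A :: "'a mat" assume "A \<in> {transvection n i j a | i j a. i < n \<and> j < n \<and> i \<noteq> j}"
  then obtain i j a where "i < n" "j < n" "i \<noteq> j" "A = transvection n i j a" by blast
  then show "A \<in> elementary_mats n"
    unfolding elementary_mats_def transvection_def
    by (simp, intro exI[of _ i] conjI exI[of _ j]) auto
qed

lemma elementary_mats_subset_GL: "elementary_mats n \<subseteq> carrier (GL n)"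
  by (auto simp: elementary_mats_eq transvection_in_GL)

lemma subgroup_E: "subgroup (E n) (GL n)"
  unfolding E_def by (rule group.generate_is_subgroup[OF group_GL elementary_mats_subset_GL])

lemma one_GL [simp]: "\<one>\<^bsub>GL n\<^esub> = 1\<^sub>m n"
  by (simp add: GL_def units_of_def square_mat_monoid_def)

lemma E_mult_closed: "A \<in> E n \<Longrightarrow> B \<in> E n \<Longrightarrow> A * B \<in> E n"
  using subgroup.m_closed[OF subgroup_E] by fastforce

lemma one_in_E: "1\<^sub>m n \<in> E n"
  using subgroup.one_closed[OF subgroup_E] by fastforce

lemma transvection_in_E: "i < n \<Longrightarrow> j < n \<Longrightarrow> i \<noteq> j \<Longrightarrow> transvection n i j a \<in> E n"
  unfolding E_def elementary_mats_eq by (rule generate.incl) blast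

text \<open>
  Clearing the entry \<open>(i, j)\<close> is a single row operation and disturbs no other entry: as \<open>j \<notin> I\<close>,
  the \<open>j\<close>-th row of \<open>U\<close> is a row of the identity matrix.
\<close>

lemma unipotent_in_E:
  fixes U :: "'a::{ring, monoid_mult} mat"
  assumes "finite S" "S \<subseteq> I \<times> J" "I \<inter> J = {}" "I \<subseteq> {..<n}" "J \<subseteq> {..<n}"
    and "U \<in> carrier_mat n n"
    and "\<And>k l. k < n \<Longrightarrow> l < n \<Longrightarrow> (k, l) \<notin> S \<Longrightarrow> U $$ (k, l) = 1\<^sub>m n $$ (k, l)"
  shows "U \<in> E n"
  using assms
proof (induction S arbitrary: U rule: finite_induct)
  case empty
  then have "U = 1\<^sub>m n" by (intro eq_matI) auto
  then show ?case by (simp add: one_in_E)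
next
  case (insert p S)
  obtain i j where p: "p = (i, j)" by fastforce
  have ij: "i \<in> I" "j \<in> J" "i < n" "j < n" "i \<noteq> j" "j \<notin> I"
    using insert.prems p by auto
  define V where "V = mat n n (\<lambda>(k, l). if (k, l) = p then 0 else U $$ (k, l))"
  have "V \<in> E n"
    using insert.prems ij(5) p by (intro insert.IH) (auto simp: V_def)
  have row_j: "U $$ (j, l) = (if j = l then 1 else 0)" if "l < n" for l
    using insert.prems(1) insert.prems(6)[of j l] that ij p by fastforce
  have "U = transvection n i j (U $$ (i, j)) * V"
    using insert.prems(5) ij p row_j
    by (subst transvection_mult[of _ _ _ _ n]) (auto simp: V_def intro!: eq_matI)
  then show ?case
    using E_mult_closed[OF transvection_in_E \<open>V \<in> E n\<close>] ij by metis
qed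

lemma upper_block_in_E:
  fixes X :: "'a::{ring, monoid_mult} mat"
  assumes "X \<in> carrier_mat n n"
  shows "four_block_mat (1\<^sub>m n) X (0\<^sub>m n n) (1\<^sub>m n) \<in> E (n + n)"
  using assms
  by (intro unipotent_in_E[where S = "{..<n} \<times> {n..<n + n}" and I = "{..<n}" and J = "{n..<n + n}"])
     auto

lemma lower_block_in_E:
  fixes X :: "'a::{ring, monoid_mult} mat"
  assumes "X \<in> carrier_mat n n"
  shows "four_block_mat (1\<^sub>m n) (0\<^sub>m n n) X (1\<^sub>m n) \<in> E (n + n)"
  using assms
  by (intro unipotent_in_E[where S = "{n..<n + n} \<times> {..<n}" and I = "{n..<n + n}" and J = "{..<n}"])
     auto

section \<open>Whitehead's lemma\<close>

definition direct_sum :: "'a::{ring, monoid_mult} mat \<Rightarrow> 'a mat \<Rightarrow> 'a mat" where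
  "direct_sum A B =
     four_block_mat A (0\<^sub>m (dim_row A) (dim_col B)) (0\<^sub>m (dim_row B) (dim_col A)) B"

lemma direct_sum_carrier [simp]:
  "A \<in> carrier_mat n n \<Longrightarrow> B \<in> carrier_mat m m \<Longrightarrow> direct_sum A B \<in> carrier_mat (n + m) (n + m)"
  by (auto simp: direct_sum_def)

lemma direct_sum_mult:
  fixes A B C D :: "'a::{ring, monoid_mult} mat"
  assumes "A \<in> carrier_mat n n" "C \<in> carrier_mat n n" "B \<in> carrier_mat m m" "D \<in> carrier_mat m m"
  shows "direct_sum A B * direct_sum C D = direct_sum (A * C) (B * D)"
  using assms unfolding direct_sum_def
  by (subst mult_four_block_mat[of _ n n _ m _ m]) auto

lemma direct_sum_one: "direct_sum (1\<^sub>m n) (1\<^sub>m m) = 1\<^sub>m (n + m)"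
  by (simp add: direct_sum_def)

lemma direct_sum_in_GL:
  assumes "A \<in> carrier (GL n)" "B \<in> carrier (GL m)"
  shows "direct_sum A B \<in> carrier (GL (n + m))"
proof -
  obtain A' B' where "A' \<in> carrier_mat n n" "A' * A = 1\<^sub>m n" "A * A' = 1\<^sub>m n"
    "B' \<in> carrier_mat m m" "B' * B = 1\<^sub>m m" "B * B' = 1\<^sub>m m"
    "A \<in> carrier_mat n n" "B \<in> carrier_mat m m"
    using assms by (auto simp: carrier_GL)
  then show ?thesis
    unfolding carrier_GL
    by (auto simp: direct_sum_mult direct_sum_one intro!: bexI[of _ "direct_sum A' B'"])
qed

lemma direct_sum_inverse_in_E:
  fixes A B :: "'a::{ring, monoid_mult} mat"
  assumes A: "A \<in> carrier_mat n n" and B: "B \<in> carrier_mat n n"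
    and AB: "A * B = 1\<^sub>m n" and BA: "B * A = 1\<^sub>m n"
  shows "direct_sum A B \<in> E (n + n)"
proof -
  let ?U = "\<lambda>X. four_block_mat (1\<^sub>m n) X (0\<^sub>m n n) (1\<^sub>m n)"
  let ?L = "\<lambda>X. four_block_mat (1\<^sub>m n) (0\<^sub>m n n) X (1\<^sub>m n)"
  have block_mult: "four_block_mat A1 B1 C1 D1 * four_block_mat A2 B2 C2 D2 =
      four_block_mat (A1 * A2 + B1 * C2) (A1 * B2 + B1 * D2) (C1 * A2 + D1 * C2) (C1 * B2 + D1 * D2)"
    if "A1 \<in> carrier_mat n n" "B1 \<in> carrier_mat n n" "C1 \<in> carrier_mat n n" "D1 \<in> carrier_mat n n"
      "A2 \<in> carrier_mat n n" "B2 \<in> carrier_mat n n" "C2 \<in> carrier_mat n n" "D2 \<in> carrier_mat n n"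
    for A1 B1 C1 D1 A2 B2 C2 D2 :: "'a mat"
    using that by (rule mult_four_block_mat)
  \<comment> \<open>Matrices of all sizes share one type, so these cancellations are established
    entrywise at the fixed size \<open>n\<close>.\<close>
  have cancel: "1\<^sub>m n + - 1\<^sub>m n = (0\<^sub>m n n :: 'a mat)" "- 1\<^sub>m n + 1\<^sub>m n = (0\<^sub>m n n :: 'a mat)"
    "- (- X) = X" for X :: "'a mat"
    by (intro eq_matI; simp)+
  \<comment> \<open>\<open>(A, 0; 0, B) = (0, A; -B, 0) (0, -1; 1, 0)\<close>, and both factors have the form treated here.\<close>
  have weyl: "?U X * (?L (- Y) * ?U X) = four_block_mat (0\<^sub>m n n) X (- Y) (0\<^sub>m n n)"
    if "X \<in> carrier_mat n n" "Y \<in> carrier_mat n n" "X * Y = 1\<^sub>m n" "Y * X = 1\<^sub>m n"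
    for X Y :: "'a mat"
    using that by (simp add: block_mult mult_one_mat cancel)
  \<comment> \<open>The second factor is \<open>weyl\<close> at
    \<open>X = Y = - 1\<^sub>m n\<close>; the double minus is kept so that it matches the pattern
    \<open>?L (- Y)\<close>.\<close>
  have "direct_sum A B = (?U A * (?L (- B) * ?U A)) *
      (?U (- 1\<^sub>m n) * (?L (- (- 1\<^sub>m n)) * ?U (- 1\<^sub>m n)))"
    using A B AB BA
    by (subst (1 2) weyl) (auto simp: block_mult mult_one_mat cancel direct_sum_def)
  then show ?thesis
    using A B by (auto intro!: E_mult_closed upper_block_in_E lower_block_in_E)
qed


section \<open>Stabilization\<close>

lemma stab_last_direct_sum: "A \<in> carrier_mat n n \<Longrightarrow> stab_last n A = direct_sum A (1\<^sub>m 1)"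
  by (auto simp: stab_last_def direct_sum_def)

lemma stab_first_direct_sum: "A \<in> carrier_mat n n \<Longrightarrow> stab_first n A = direct_sum (1\<^sub>m 1) A"
  by (auto simp: stab_first_def direct_sum_def)

text \<open>Peeling one row and column off the identity block makes induction on \<open>k\<close>
  available: facts about a single stabilization become facts about direct sums with an identity of
  any size. \<open>direct_sum_Suc_one\<close> does the same on the other side.\<close>

lemma direct_sum_one_Suc:
  "A \<in> carrier_mat n n \<Longrightarrow> direct_sum A (1\<^sub>m (Suc k)) = stab_last (n + k) (direct_sum A (1\<^sub>m k))"
  by (intro eq_matI) (auto simp: direct_sum_def stab_last_def)

lemma direct_sum_Suc_one:
  "A \<in> carrier_mat n n \<Longrightarrow> direct_sum (1\<^sub>m (Suc k)) A = stab_first (k + n) (direct_sum (1\<^sub>m k) A)"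
  by (intro eq_matI) (auto simp: direct_sum_def stab_first_def)

lemma direct_sum_one_0:
  "A \<in> carrier_mat n n \<Longrightarrow> direct_sum A (1\<^sub>m 0) = A"
  "A \<in> carrier_mat n n \<Longrightarrow> direct_sum (1\<^sub>m 0) A = A"
  by (intro eq_matI; auto simp: direct_sum_def)+

lemma GL_carrier_mat: "A \<in> carrier (GL n) \<Longrightarrow> A \<in> carrier_mat n n"
  by (simp add: carrier_GL)

lemma one_in_GL: "1\<^sub>m n \<in> carrier (GL n)"
  using monoid.one_closed[OF group.is_monoid[OF group_GL]] by fastforce

lemma E_subset_GL: "E n \<subseteq> carrier (GL n)"
  using subgroup.subset[OF subgroup_E] .

lemma stab_last_hom: "stab_last n \<in> hom (GL n) (GL (Suc n))"
proof (rule homI)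
  fix A :: "'a mat" assume A: "A \<in> carrier (GL n)"
  then show "stab_last n A \<in> carrier (GL (Suc n))"
    using direct_sum_in_GL[OF A one_in_GL[of 1]]
    by (simp add: stab_last_direct_sum GL_carrier_mat)
  fix B :: "'a mat" assume B: "B \<in> carrier (GL n)"
  have c: "A \<in> carrier_mat n n" "B \<in> carrier_mat n n" "A * B \<in> carrier_mat n n"
    using A B by (auto dest!: GL_carrier_mat)
  have "direct_sum A (1\<^sub>m 1) * direct_sum B (1\<^sub>m 1) = direct_sum (A * B) (1\<^sub>m 1 * 1\<^sub>m 1)"
    using c by (intro direct_sum_mult[where m = 1]) auto
  then show "stab_last n (A \<otimes>\<^bsub>GL n\<^esub> B) = stab_last n A \<otimes>\<^bsub>GL (Suc n)\<^esub> stab_last n B"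
    using c by (simp add: stab_last_direct_sum mult_one_mat)
qed

lemma stab_last_transvection:
  "i < n \<Longrightarrow> j < n \<Longrightarrow> stab_last n (transvection n i j a) = transvection (Suc n) i j a"
  by (intro eq_matI) (auto simp: stab_last_def transvection_def)

text \<open>The image of a generated subgroup is generated by the image of the generators, and
  stabilizing a transvection gives the transvection with the same indices and entry.\<close>

lemma stab_last_in_E:
  fixes A :: "'a::{ring, monoid_mult} mat"
  assumes "A \<in> E n"
  shows "stab_last n A \<in> E (Suc n)"
proof -
  interpret group_hom "GL n :: 'a mat monoid" "GL (Suc n)" "stab_last n"
    by (simp add: group_hom_def group_hom_axioms_def group_GL stab_last_hom)
  have "stab_last n ` elementary_mats n \<subseteq> (elementary_mats (Suc n) :: 'a mat set)"
  proof
    fix B :: "'a mat" assume "B \<in> stab_last n ` elementary_mats n"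
    then obtain i j a where "i < n" "j < n" "i \<noteq> j" "B = stab_last n (transvection n i j a)"
      by (auto simp: elementary_mats_eq)
    then have "B = transvection (Suc n) i j a" "i < Suc n" "j < Suc n" "i \<noteq> j"
      by (auto simp: stab_last_transvection)
    then show "B \<in> elementary_mats (Suc n)"
      unfolding elementary_mats_eq by blast
  qed
  then have "stab_last n ` E n \<subseteq> (E (Suc n) :: 'a mat set)"
    unfolding E_def generate_img[OF elementary_mats_subset_GL, symmetric]
    by (rule H.mono_generate)
  then show ?thesis using assms by blast
qed

lemma direct_sum_one_in_E: "A \<in> E n \<Longrightarrow> direct_sum A (1\<^sub>m k) \<in> E (n + k)"
proof (induction k)
  case 0
  then show ?case using E_subset_GL by (force simp: direct_sum_one_0 dest!: GL_carrier_mat)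
next
  case (Suc k)
  then have "A \<in> carrier_mat n n" using E_subset_GL GL_carrier_mat by blast
  then show ?case using stab_last_in_E Suc by (simp add: direct_sum_one_Suc)
qed

section \<open>The group structure on the stable general linear group\<close>

lemma to_stable_direct_sum_one:
  "A \<in> carrier_mat n n \<Longrightarrow> to_stable (n + k) (direct_sum A (1\<^sub>m k)) = to_stable n A"
  by (intro ext) (auto simp: to_stable_def direct_sum_def)

lemma to_stable_one: "to_stable n (1\<^sub>m n) = \<one>\<^bsub>GL_stable\<^esub>"
  by (intro ext) (simp add: to_stable_def GL_stable_def)

lemma to_stable_in_GL_stable: "n \<ge> 3 \<Longrightarrow> A \<in> carrier (GL n) \<Longrightarrow> to_stable n A \<in> carrier GL_stable"
  by (auto simp: GL_stable_def)

text \<open>Padding by an identity block gives a representative in every size from some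
  \<open>m\<close> on, so finitely many stable matrices can be represented in one common
  size.\<close>

lemma GL_stable_representatives:
  assumes "f \<in> carrier GL_stable"
  obtains m where "m \<ge> 3" "\<And>n. n \<ge> m \<Longrightarrow> \<exists>A\<in>carrier (GL n). f = to_stable n A"
proof -
  obtain m A where m: "m \<ge> 3" "A \<in> carrier (GL m)" "f = to_stable m A"
    using assms by (auto simp: GL_stable_def)
  have "\<exists>B\<in>carrier (GL n). f = to_stable n B" if "n \<ge> m" for n
    using direct_sum_in_GL[OF m(2) one_in_GL[of "n - m"]] that m
      to_stable_direct_sum_one[OF GL_carrier_mat[OF m(2)], of "n - m"]
    by (intro bexI[of _ "direct_sum A (1\<^sub>m (n - m))"]) auto
  then show thesis using that m(1) by blast
qed

lemma GL_stable_representatives2: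
  assumes "f \<in> carrier GL_stable" "g \<in> carrier GL_stable"
  obtains n A B where "n \<ge> 3" "A \<in> carrier (GL n)" "B \<in> carrier (GL n)"
    "f = to_stable n A" "g = to_stable n B"
proof -
  obtain k where k: "k \<ge> 3" "\<And>n. n \<ge> k \<Longrightarrow> \<exists>A\<in>carrier (GL n). f = to_stable n A"
    using GL_stable_representatives[OF assms(1)] by blast
  obtain l where l: "l \<ge> 3" "\<And>n. n \<ge> l \<Longrightarrow> \<exists>A\<in>carrier (GL n). g = to_stable n A"
    using GL_stable_representatives[OF assms(2)] by blast
  show thesis
    using k(1) k(2)[of "max k l"] l(2)[of "max k l"] that[of "max k l"] by auto
qed

lemma to_stable_mult_GL:
  assumes "A \<in> carrier (GL n)" "B \<in> carrier (GL n)"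
  shows "to_stable n A \<otimes>\<^bsub>GL_stable\<^esub> to_stable n B = to_stable n (A * B)"
  using assms by (simp add: to_stable_mult GL_carrier_mat)

lemma GL_mult_closed: "A \<in> carrier (GL n) \<Longrightarrow> B \<in> carrier (GL n) \<Longrightarrow> A * B \<in> carrier (GL n)"
  using monoid.m_closed[OF group.is_monoid[OF group_GL]] by fastforce

lemma GL_inverse:
  assumes "A \<in> carrier (GL n)"
  obtains B where "B \<in> carrier (GL n)" "A * B = 1\<^sub>m n" "B * A = 1\<^sub>m n"
  using assms by (auto simp: carrier_GL)

text \<open>Each axiom involves finitely many elements, so it reduces to the same axiom in some
  \<open>GL n\<close>, where all of them have representatives.\<close>

lemma group_GL_stable: "group GL_stable"
proof (rule groupI)
  fix f g :: "nat \<Rightarrow> nat \<Rightarrow> 'a"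
  assume fg: "f \<in> carrier GL_stable" "g \<in> carrier GL_stable"
  show "f \<otimes>\<^bsub>GL_stable\<^esub> g \<in> carrier GL_stable"
    by (rule GL_stable_representatives2[OF fg])
      (simp add: to_stable_mult_GL to_stable_in_GL_stable GL_mult_closed)
  fix h :: "nat \<Rightarrow> nat \<Rightarrow> 'a"
  assume h: "h \<in> carrier GL_stable"
  obtain k where k: "k \<ge> 3" "\<And>n. n \<ge> k \<Longrightarrow> \<exists>A\<in>carrier (GL n). f = to_stable n A"
    using GL_stable_representatives[OF fg(1)] by blast
  obtain l where l: "l \<ge> 3" "\<And>n. n \<ge> l \<Longrightarrow> \<exists>A\<in>carrier (GL n). g = to_stable n A"
    using GL_stable_representatives[OF fg(2)] by blast
  obtain m where m: "m \<ge> 3" "\<And>n. n \<ge> m \<Longrightarrow> \<exists>A\<in>carrier (GL n). h = to_stable n A"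
    using GL_stable_representatives[OF h] by blast
  define n where "n = k + l + m"
  obtain A B C where ABC: "A \<in> carrier (GL n)" "B \<in> carrier (GL n)" "C \<in> carrier (GL n)"
    and "f = to_stable n A" "g = to_stable n B" "h = to_stable n C"
    using k(2)[of n] l(2)[of n] m(2)[of n] by (auto simp: n_def)
  moreover have "A * B * C = A * (B * C)"
    using ABC[THEN GL_carrier_mat] by (rule assoc_mult_mat)
  ultimately show "f \<otimes>\<^bsub>GL_stable\<^esub> g \<otimes>\<^bsub>GL_stable\<^esub> h = f \<otimes>\<^bsub>GL_stable\<^esub> (g \<otimes>\<^bsub>GL_stable\<^esub> h)"
    by (simp add: to_stable_mult_GL GL_mult_closed)
next
  show "\<one>\<^bsub>GL_stable\<^esub> \<in> carrier GL_stable"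
    using to_stable_in_GL_stable[OF _ one_in_GL[of 3]] by (simp add: to_stable_one)
next
  fix f :: "nat \<Rightarrow> nat \<Rightarrow> 'a" assume f: "f \<in> carrier GL_stable"
  then obtain n A where n: "n \<ge> 3" "A \<in> carrier (GL n)" "f = to_stable n A"
    using GL_stable_representatives by (metis order_refl)
  then show "\<one>\<^bsub>GL_stable\<^esub> \<otimes>\<^bsub>GL_stable\<^esub> f = f"
    by (simp add: to_stable_mult_GL one_in_GL mult_one_mat GL_carrier_mat flip: to_stable_one[of n])
  obtain B where "B \<in> carrier (GL n)" "B * A = 1\<^sub>m n" using GL_inverse[OF n(2)] by metis
  then show "\<exists>g\<in>carrier GL_stable. g \<otimes>\<^bsub>GL_stable\<^esub> f = \<one>\<^bsub>GL_stable\<^esub>"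
    using n by (intro bexI[of _ "to_stable n B"])
      (auto simp: to_stable_mult_GL to_stable_in_GL_stable to_stable_one)
qed

lemma to_stable_hom: "n \<ge> 3 \<Longrightarrow> to_stable n \<in> hom (GL n) GL_stable"
  by (auto intro!: homI simp: to_stable_in_GL_stable to_stable_mult_GL)

lemma to_stable_group_hom: "n \<ge> 3 \<Longrightarrow> group_hom (GL n) GL_stable (to_stable n)"
  by (simp add: group_hom_def group_hom_axioms_def group_GL group_GL_stable to_stable_hom)

section \<open>The group \<open>K\<^sub>1\<close>\<close>

lemma to_stable_in_E_stable: "n \<ge> 3 \<Longrightarrow> A \<in> E n \<Longrightarrow> to_stable n A \<in> E_stable"
  by (auto simp: E_stable_def)

text \<open>Inverses stay inside one \<open>E n\<close>. For products the union is directed: padding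
  a factor of size \<open>n\<close> by \<open>m\<close> and one of size \<open>m\<close> by
  \<open>n\<close> brings both into \<open>E (n + m)\<close>.\<close>

lemma subgroup_E_stable: "subgroup E_stable GL_stable"
proof (rule group.subgroupI[OF group_GL_stable])
  show "E_stable \<subseteq> carrier GL_stable"
    using E_subset_GL by (fastforce simp: E_stable_def GL_stable_def)
  show "E_stable \<noteq> {}"
    using to_stable_in_E_stable[OF _ one_in_E[of 3]] by auto
next
  fix f :: "nat \<Rightarrow> nat \<Rightarrow> 'a" assume "f \<in> E_stable"
  then obtain n A where n: "n \<ge> 3" "A \<in> E n" "f = to_stable n A"
    by (auto simp: E_stable_def)
  interpret group_hom "GL n :: 'a mat monoid" GL_stable "to_stable n"
    by (rule to_stable_group_hom[OF n(1)])
  have "inv\<^bsub>GL_stable\<^esub> f = to_stable n (inv\<^bsub>GL n\<^esub> A)"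
    using n E_subset_GL[THEN subsetD, OF n(2)] by simp
  moreover have "inv\<^bsub>GL n\<^esub> A \<in> E n"
    using subgroup.m_inv_closed[OF subgroup_E n(2)] .
  ultimately show "inv\<^bsub>GL_stable\<^esub> f \<in> E_stable"
    using n(1) by (simp add: to_stable_in_E_stable)
next
  fix f g :: "nat \<Rightarrow> nat \<Rightarrow> 'a" assume "f \<in> E_stable" "g \<in> E_stable"
  then obtain n m A B where nm: "n \<ge> 3" "A \<in> E n" "f = to_stable n A"
      "m \<ge> 3" "B \<in> E m" "g = to_stable m B"
    by (auto simp: E_stable_def)
  let ?A = "direct_sum A (1\<^sub>m m)" and ?B = "direct_sum B (1\<^sub>m n)"
  have AB: "?A \<in> E (n + m)" "?B \<in> E (n + m)"
    using direct_sum_one_in_E[OF nm(2), of m] direct_sum_one_in_E[OF nm(5), of n]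
    by (simp_all add: add.commute)
  have "f = to_stable (n + m) ?A" "g = to_stable (m + n) ?B"
    using nm E_subset_GL GL_carrier_mat by (metis to_stable_direct_sum_one subsetD)+
  then have "f \<otimes>\<^bsub>GL_stable\<^esub> g = to_stable (n + m) (?A * ?B)"
    using AB[THEN E_subset_GL[THEN subsetD]] by (simp add: to_stable_mult_GL add.commute)
  then show "f \<otimes>\<^bsub>GL_stable\<^esub> g \<in> E_stable"
    using nm(1) AB by (simp add: to_stable_in_E_stable E_mult_closed)
qed

text \<open>After doubling the size, a commutator padded by an identity block is a product of three
  matrices diag(X, Y) with X and Y mutually inverse, and padding does not change the stable matrix.
  The form fg = e(gf) serves both the normality of \<open>E_stable\<close> and the commutativity of
  the quotient.\<close>

lemma E_stable_contains_commutators: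
  assumes "f \<in> carrier GL_stable" "g \<in> carrier GL_stable"
  obtains e where "e \<in> E_stable"
    "f \<otimes>\<^bsub>GL_stable\<^esub> g = e \<otimes>\<^bsub>GL_stable\<^esub> (g \<otimes>\<^bsub>GL_stable\<^esub> f)"
proof -
  obtain n A B where n: "n \<ge> 3" "A \<in> carrier (GL n)" "B \<in> carrier (GL n)"
    "f = to_stable n A" "g = to_stable n B"
    using GL_stable_representatives2[OF assms] .
  obtain A' where A': "A' \<in> carrier (GL n)" "A * A' = 1\<^sub>m n" "A' * A = 1\<^sub>m n"
    using GL_inverse[OF n(2)] .
  obtain B' where B': "B' \<in> carrier (GL n)" "B * B' = 1\<^sub>m n" "B' * B = 1\<^sub>m n"
    using GL_inverse[OF n(3)] .
  note c = GL_carrier_mat[OF n(2)] GL_carrier_mat[OF n(3)]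
    GL_carrier_mat[OF A'(1)] GL_carrier_mat[OF B'(1)]
  have closed: "X * Y \<in> carrier_mat n n"
    if "X \<in> carrier_mat n n" "Y \<in> carrier_mat n n" for X Y :: "'a mat"
    using that by (rule mult_carrier_mat)
  have assoc: "X * Y * Z = X * (Y * Z)"
    if "X \<in> carrier_mat n n" "Y \<in> carrier_mat n n" "Z \<in> carrier_mat n n" for X Y Z :: "'a mat"
    using that by (rule assoc_mult_mat)
  \<comment> \<open>Since \<open>assoc\<close> nests products to the right, an inverse pair has to
    cancel in front of a remaining factor \<open>X\<close> as well.\<close>
  have red: "A * (A' * X) = X" "A' * (A * X) = X" "B * (B' * X) = X" "B' * (B * X) = X"
    if "X \<in> carrier_mat n n" for X
    using that A'(2,3) B'(2,3) c by (simp_all add: assoc[symmetric] mult_one_mat del: assoc_mult_mat)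
  have inv: "(A * B) * (B' * A') = 1\<^sub>m n" "(B' * A') * (A * B) = 1\<^sub>m n"
    using A'(2,3) B'(2,3) c by (simp_all add: assoc red closed del: assoc_mult_mat)
  have AB: "A * B = A * B * (A' * B') * (B * A)"
    using A'(3) c by (simp add: assoc red closed mult_one_mat del: assoc_mult_mat)
  let ?C = "A * B * (A' * B')"
  \<comment> \<open>\<open>diag([A, B], 1) = diag(AB, (AB)\<inverse>) diag(A\<inverse>, A) diag(B\<inverse>, B)\<close>\<close>
  have "direct_sum (A * B) (B' * A') * (direct_sum A' A * direct_sum B' B) \<in> E (n + n)"
    using A'(2,3) B'(2,3) inv c
    by (intro E_mult_closed direct_sum_inverse_in_E) (simp_all add: closed del: assoc_mult_mat)
  also have "direct_sum (A * B) (B' * A') * (direct_sum A' A * direct_sum B' B) =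
      direct_sum ?C (1\<^sub>m n)"
    using inv(2) c by (simp add: direct_sum_mult[where n = n and m = n] closed del: assoc_mult_mat)
  finally have "to_stable n ?C \<in> E_stable"
    using to_stable_in_E_stable[of "n + n" "direct_sum ?C (1\<^sub>m n)"] n(1) c
      to_stable_direct_sum_one[of ?C n n]
    by (simp add: closed del: assoc_mult_mat)
  moreover note AB
  ultimately show thesis
    using that[of "to_stable n ?C"] n(2-5) A'(1) B'(1)
    by (simp add: to_stable_mult_GL GL_mult_closed del: assoc_mult_mat)
qed

text \<open>A subgroup containing all commutators is normal: the conjugate of \<open>e\<close> by
  \<open>f\<close> is \<open>e\<close> multiplied by the commutator of \<open>f\<close> and
  \<open>e\<close>.\<close>

lemma E_stable_normal: "E_stable \<lhd> GL_stable"
proof (rule group.normal_invI[OF group_GL_stable subgroup_E_stable])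
  fix f e :: "nat \<Rightarrow> nat \<Rightarrow> 'a"
  assume f: "f \<in> carrier GL_stable" and e: "e \<in> E_stable"
  interpret group GL_stable by (rule group_GL_stable)
  interpret E: subgroup E_stable GL_stable by (rule subgroup_E_stable)
  have e': "e \<in> carrier GL_stable" using e by simp
  obtain e2 where "e2 \<in> E_stable"
    "f \<otimes>\<^bsub>GL_stable\<^esub> e = e2 \<otimes>\<^bsub>GL_stable\<^esub> (e \<otimes>\<^bsub>GL_stable\<^esub> f)"
    using E_stable_contains_commutators[OF f e'] .
  then have "f \<otimes>\<^bsub>GL_stable\<^esub> e \<otimes>\<^bsub>GL_stable\<^esub> inv\<^bsub>GL_stable\<^esub> f = e2 \<otimes>\<^bsub>GL_stable\<^esub> e"
    using f e' by (simp add: m_assoc)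
  then show "f \<otimes>\<^bsub>GL_stable\<^esub> e \<otimes>\<^bsub>GL_stable\<^esub> inv\<^bsub>GL_stable\<^esub> f \<in> E_stable"
    using e \<open>e2 \<in> E_stable\<close> by simp
qed

lemma group_K1: "group K1"
  unfolding K1_def by (rule normal.factorgroup_is_group[OF E_stable_normal])

lemma carrier_K1:
  "carrier K1 = {to_K1 n A | n A. n \<ge> 3 \<and> A \<in> carrier (GL n)}"
  by (auto simp: K1_def carrier_FactGroup to_K1_def GL_stable_def)

lemma to_K1_hom: "n \<ge> 3 \<Longrightarrow> to_K1 n \<in> hom (GL n) K1"
  using hom_compose[OF to_stable_hom normal.r_coset_hom_Mod[OF E_stable_normal]]
  unfolding K1_def to_K1_def[abs_def] comp_def .

lemma to_K1_stab_last:
  "A \<in> carrier (GL n) \<Longrightarrow> to_K1 (Suc n) (stab_last n A) = to_K1 n A"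
  by (simp add: to_K1_def to_stable_stab_last GL_carrier_mat)

text \<open>The two products differ by a left factor from \<open>E_stable\<close>, hence lie in the
  same right coset.\<close>

lemma to_K1_commute:
  assumes "n \<ge> 3" "A \<in> carrier (GL n)" "B \<in> carrier (GL n)"
  shows "to_K1 n (A * B) = to_K1 n (B * A)"
proof -
  interpret group GL_stable by (rule group_GL_stable)
  have A: "to_stable n A \<in> carrier GL_stable" and B: "to_stable n B \<in> carrier GL_stable"
    using assms by (simp_all add: to_stable_in_GL_stable)
  obtain e where e: "e \<in> E_stable"
    "to_stable n A \<otimes>\<^bsub>GL_stable\<^esub> to_stable n B =
     e \<otimes>\<^bsub>GL_stable\<^esub> (to_stable n B \<otimes>\<^bsub>GL_stable\<^esub> to_stable n A)"
    using E_stable_contains_commutators[OF A B] .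
  then have "to_stable n (A * B) \<in> E_stable #>\<^bsub>GL_stable\<^esub> to_stable n (B * A)"
    using assms by (auto simp: r_coset_def to_stable_mult_GL)
  then show ?thesis
    unfolding to_K1_def
    using repr_independence subgroup_E_stable to_stable_in_GL_stable[OF assms(1)]
      GL_mult_closed[OF assms(3,2)] by metis
qed

text \<open>
  The two stabilizations of \<open>A\<close> are conjugate by the matrix \<open>P\<close> of a cyclic permutation, so they
  agree in the abelian group \<open>K\<^sub>1\<close>, whatever the class of \<open>P\<close>.
\<close>

lemma to_K1_stab_first:
  fixes A :: "'a::{ring, monoid_mult} mat"
  assumes n: "n \<ge> 3" and A: "A \<in> carrier (GL n)"
  shows "to_K1 (Suc n) (stab_first n A) = to_K1 n A"
proof -
  \<comment> \<open>On the indices \<open>0\<close> to \<open>n\<close>, \<open>p\<close> and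
    \<open>q\<close> are the cyclic shifts down and up, inverse to each other. Thus \<open>P\<close>
    permutes rows by \<open>p\<close> from the left and columns by \<open>q\<close> from the
    right.\<close>
  define p where "p i = (if i = 0 then n else i - 1)" for i
  define q where "q i = (if i = n then 0 else Suc i)" for i
  define P :: "'a mat" where "P = mat (Suc n) (Suc n) (\<lambda>(i, j). if j = p i then 1 else 0)"
  define Q :: "'a mat" where "Q = mat (Suc n) (Suc n) (\<lambda>(i, j). if j = q i then 1 else 0)"
  have mem: "p i < Suc n" "q i < Suc n" if "i < Suc n" for i
    using that by (auto simp: p_def q_def)
  have pq: "i = q j \<longleftrightarrow> j = p i" if "i < Suc n" "j < Suc n" for i j
    using that by (auto simp: p_def q_def)
  have permute: "P * X = mat (Suc n) (Suc n) (\<lambda>(i, j). X $$ (p i, j))"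
    "Q * X = mat (Suc n) (Suc n) (\<lambda>(i, j). X $$ (q i, j))"
    "X * P = mat (Suc n) (Suc n) (\<lambda>(i, j). X $$ (i, q j))"
    if X: "X \<in> carrier_mat (Suc n) (Suc n)" for X
  proof -
    have "(\<Sum>r = 0..<Suc n. (if r = s then 1 else 0) * X $$ (r, j)) = X $$ (s, j)"
      and "(\<Sum>r = 0..<Suc n. X $$ (j, r) * (if r = s then 1 else 0)) = X $$ (j, s)"
      if "s < Suc n" for s j
      using that by (simp_all add: if_distrib[of "\<lambda>c. c * _"] if_distrib[of "\<lambda>c. _ * c"]
          cong: if_cong)
    note sums = this
    show "P * X = mat (Suc n) (Suc n) (\<lambda>(i, j). X $$ (p i, j))"
      "Q * X = mat (Suc n) (Suc n) (\<lambda>(i, j). X $$ (q i, j))"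
      using X by (auto intro!: eq_matI sums mem simp: P_def Q_def scalar_prod_def
          simp del: sum.atLeast0_lessThan_Suc sum.op_ivl_Suc)
    show "X * P = mat (Suc n) (Suc n) (\<lambda>(i, j). X $$ (i, q j))"
    proof (rule eq_matI)
      fix i j assume "i < dim_row (mat (Suc n) (Suc n) (\<lambda>(i, j). X $$ (i, q j)))"
        and "j < dim_col (mat (Suc n) (Suc n) (\<lambda>(i, j). X $$ (i, q j)))"
      then have ij: "i < Suc n" "j < Suc n" by auto
      then have "(X * P) $$ (i, j) =
          (\<Sum>r = 0..<Suc n. X $$ (i, r) * (if r = q j then 1 else 0))"
        using X by (auto intro!: sum.cong simp: P_def scalar_prod_def pq
            simp del: sum.atLeast0_lessThan_Suc sum.op_ivl_Suc)
      then show "(X * P) $$ (i, j) = mat (Suc n) (Suc n) (\<lambda>(i, j). X $$ (i, q j)) $$ (i, j)"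
        using ij sums(2)[OF mem(2)[OF ij(2)]] by simp
    qed (use X in \<open>auto simp: P_def\<close>)
  qed
  have inv: "q (p i) = i" "p (q i) = i" if "i < Suc n" for i
    using that by (auto simp: p_def q_def)
  have Q: "Q \<in> carrier_mat (Suc n) (Suc n)" and P': "P \<in> carrier_mat (Suc n) (Suc n)"
    by (simp_all add: P_def Q_def)
  have PQ: "P * Q = 1\<^sub>m (Suc n)" "Q * P = 1\<^sub>m (Suc n)"
    unfolding permute(1)[OF Q] permute(2)[OF P'] by (auto intro!: eq_matI simp: P_def Q_def mem inv)
  have P: "P \<in> carrier (GL (Suc n))"
    using PQ P' Q by (auto simp: carrier_GL)
  have c: "A \<in> carrier_mat n n" using A by (rule GL_carrier_mat)
  have L: "stab_last n A \<in> carrier (GL (Suc n))" and F: "stab_first n A \<in> carrier (GL (Suc n))"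
    using direct_sum_in_GL[OF A one_in_GL[of 1]] direct_sum_in_GL[OF one_in_GL[of 1] A] c
    by (simp_all add: stab_last_direct_sum stab_first_direct_sum)
  \<comment> \<open>Both products are the matrix with \<open>1\<close> in the upper right corner,
    \<open>A\<close> in the lower left block and zeros elsewhere.\<close>
  have conj: "P * stab_last n A = stab_first n A * P"
    unfolding permute(1)[OF GL_carrier_mat[OF L]] permute(3)[OF GL_carrier_mat[OF F]]
    using c by (intro eq_matI) (auto simp: stab_last_def stab_first_def p_def q_def)
  have hom: "to_K1 (Suc n) \<in> hom (GL (Suc n)) K1" using n by (intro to_K1_hom) simp
  interpret K1: group K1 by (rule group_K1)
  have "to_K1 (Suc n) P \<otimes>\<^bsub>K1\<^esub> to_K1 (Suc n) (stab_last n A) = to_K1 (Suc n) (P * stab_last n A)"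
    using hom_mult[OF hom P L] by simp
  \<comment> \<open>By \<open>conj\<close> the product equals \<open>stab_first n A * P\<close>; its
    factors may be exchanged only after passing to \<open>K1\<close>. The class of \<open>P\<close>
    then cancels on the left.\<close>
  also have "\<dots> = to_K1 (Suc n) (P * stab_first n A)"
    using to_K1_commute[OF _ P F] n conj by simp
  also have "\<dots> = to_K1 (Suc n) P \<otimes>\<^bsub>K1\<^esub> to_K1 (Suc n) (stab_first n A)"
    using hom_mult[OF hom P F] by simp
  finally show ?thesis
    using hom_in_carrier[OF hom P] hom_in_carrier[OF hom L] hom_in_carrier[OF hom F]
    unfolding to_K1_stab_last[OF A] by (metis K1.Units_eq K1.Units_l_cancel)
qed

lemma GL_cocone_K1: "GL_cocone K1 to_K1"
  by (simp add: GL_cocone_def group_K1 to_K1_hom to_K1_stab_first to_K1_stab_last)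

section \<open>Cocones factor through \<open>K\<^sub>1\<close>\<close>

lemma GL_coconeD:
  assumes "GL_cocone H \<beta>"
  shows "group H"
    and "n \<ge> 3 \<Longrightarrow> group_hom (GL n) H (\<beta> n)"
    and "n \<ge> 3 \<Longrightarrow> \<beta> n \<in> hom (GL n) H"
  using assms by (auto simp: GL_cocone_def group_hom_def group_hom_axioms_def group_GL)

lemma GL_cocone_direct_sum:
  assumes "GL_cocone H \<beta>" "n \<ge> 3" "A \<in> carrier (GL n)"
  shows "\<beta> (n + k) (direct_sum A (1\<^sub>m k)) = \<beta> n A"
    and "\<beta> (k + n) (direct_sum (1\<^sub>m k) A) = \<beta> n A"
proof (induction k)
  case 0
  {
    case 1 then show ?case using GL_carrier_mat[OF assms(3)] by (simp add: direct_sum_one_0)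
  next
    case 2 then show ?case using GL_carrier_mat[OF assms(3)] by (simp add: direct_sum_one_0)
  }
next
  case (Suc k)
  note c = GL_carrier_mat[OF assms(3)]
  {
    case 1
    then show ?case
      using assms Suc c direct_sum_in_GL[OF assms(3) one_in_GL[of k]]
      by (simp add: direct_sum_one_Suc GL_cocone_def)
  next
    case 2
    then show ?case
      using assms Suc c direct_sum_in_GL[OF one_in_GL[of k] assms(3)]
      by (simp add: direct_sum_Suc_one GL_cocone_def)
  }
qed

text \<open>Doubling the size moves \<open>A\<close> and \<open>B\<close> into complementary
  diagonal blocks, where they commute. The cocone condition for \<open>stab_last\<close> is used for
  \<open>A\<close>, that for \<open>stab_first\<close> for \<open>B\<close>.\<close>

lemma GL_cocone_commute:
  assumes "GL_cocone H \<beta>" "n \<ge> 3" "A \<in> carrier (GL n)" "B \<in> carrier (GL n)"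
  shows "\<beta> n A \<otimes>\<^bsub>H\<^esub> \<beta> n B = \<beta> n B \<otimes>\<^bsub>H\<^esub> \<beta> n A"
proof -
  let ?A = "direct_sum A (1\<^sub>m n)" and ?B = "direct_sum (1\<^sub>m n) B"
  have hom: "\<beta> (n + n) \<in> hom (GL (n + n)) H"
    using GL_coconeD(3)[OF assms(1)] assms(2) by simp
  have c: "A \<in> carrier_mat n n" "B \<in> carrier_mat n n" using assms by (auto simp: GL_carrier_mat)
  have AB: "?A \<in> carrier (GL (n + n))" "?B \<in> carrier (GL (n + n))"
    using assms by (auto intro: direct_sum_in_GL one_in_GL)
  have "?A * ?B = ?B * ?A"
    using c by (simp add: direct_sum_mult[where n = n and m = n] mult_one_mat)
  then have "\<beta> (n + n) ?A \<otimes>\<^bsub>H\<^esub> \<beta> (n + n) ?B = \<beta> (n + n) ?B \<otimes>\<^bsub>H\<^esub> \<beta> (n + n) ?A"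
    using hom_mult[OF hom AB] hom_mult[OF hom AB(2) AB(1)] by simp
  then show ?thesis
    using GL_cocone_direct_sum(1)[OF assms(1,2,3)] GL_cocone_direct_sum(2)[OF assms(1,2,4)] by simp
qed

lemma GL_cocone_E:
  fixes A :: "'a::{ring, monoid_mult} mat"
  assumes "GL_cocone H \<beta>" "n \<ge> 3" "A \<in> E n"
  shows "\<beta> n A = \<one>\<^bsub>H\<^esub>"
proof -
  interpret group_hom "GL n" H "\<beta> n" by (rule GL_coconeD(2)[OF assms(1,2)])
  \<comment> \<open>The kernel is a subgroup, so generators suffice.\<close>
  have "elementary_mats n \<subseteq> kernel (GL n) H (\<beta> n)"
  proof
    fix A :: "'a mat" assume "A \<in> elementary_mats n"
    then obtain i j a where ij: "i < n" "j < n" "i \<noteq> j" "A = transvection n i j a"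
      by (auto simp: elementary_mats_eq)
    \<comment> \<open>A third index, available because \<open>n \<ge> 3\<close>, is what turns
      e_ij(a) into the commutator of e_ik(a) and e_kj(1).\<close>
    obtain k where k: "k < n" "k \<noteq> i" "k \<noteq> j"
    proof -
      have "card {i, j} < card {..<n}" using assms(2) ij by simp
      then obtain k where "k \<in> {..<n}" "k \<notin> {i, j}"
        by (metis card_mono finite.emptyI finite.insertI leD subsetI)
      then show thesis using that by simp
    qed
    let ?X = "transvection n i k a" and ?Y = "transvection n k j 1"
    have A: "A \<in> carrier (GL n)" and X: "?X \<in> carrier (GL n)" and Y: "?Y \<in> carrier (GL n)"
      using ij k by (auto intro!: transvection_in_GL)
    have "?X * ?Y = A * (?Y * ?X)"
      using transvection_commutator[of i n j k a 1] ij k by simp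
    then have "\<beta> n ?X \<otimes>\<^bsub>H\<^esub> \<beta> n ?Y = \<beta> n A \<otimes>\<^bsub>H\<^esub> (\<beta> n ?Y \<otimes>\<^bsub>H\<^esub> \<beta> n ?X)"
      using hom_mult[OF X Y] hom_mult[OF Y X] hom_mult[OF A GL_mult_closed[OF Y X]] by simp
    \<comment> \<open>Once the left side is commuted, both sides end in the same element, which
      cancels on the right.\<close>
    then have "\<beta> n A = \<one>\<^bsub>H\<^esub>"
      unfolding GL_cocone_commute[OF assms(1,2) X Y] using A X Y
      by (metis H.m_closed H.r_cancel_one' hom_closed)
    then show "A \<in> kernel (GL n) H (\<beta> n)"
      using A by (simp add: kernel_def)
  qed
  then have "E n \<subseteq> kernel (GL n) H (\<beta> n)"
    unfolding E_def by (rule G.generate_subgroup_incl) (rule subgroup_kernel)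
  then show ?thesis using assms(3) by (auto simp: kernel_def)
qed

text \<open>This makes the induced map on the union well defined. Padded to the common size
  \<open>n + m\<close>, the two matrices coincide by injectivity of \<open>to_stable\<close>, and
  padding does not change the value of a cocone.\<close>

lemma GL_cocone_to_stable_cong:
  assumes "GL_cocone H \<beta>" "n \<ge> 3" "m \<ge> 3" "A \<in> carrier (GL n)" "B \<in> carrier (GL m)"
    and "to_stable n A = to_stable m B"
  shows "\<beta> n A = \<beta> m B"
proof -
  let ?A = "direct_sum A (1\<^sub>m m)" and ?B = "direct_sum B (1\<^sub>m n)"
  have "?A \<in> carrier (GL (n + m))" "?B \<in> carrier (GL (n + m))"
    using direct_sum_in_GL[OF assms(4) one_in_GL[of m]] direct_sum_in_GL[OF assms(5) one_in_GL[of n]]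
    by (simp_all add: add.commute)
  moreover have "to_stable (n + m) ?A = to_stable (n + m) ?B"
    using to_stable_direct_sum_one[OF GL_carrier_mat[OF assms(4)], of m]
      to_stable_direct_sum_one[OF GL_carrier_mat[OF assms(5)], of n] assms(6)
    by (simp add: add.commute)
  ultimately have "?A = ?B" using inj_on_to_stable by (auto dest: inj_onD)
  then show ?thesis
    using GL_cocone_direct_sum(1)[OF assms(1,2,4), of m]
      GL_cocone_direct_sum(1)[OF assms(1,3,5), of n]
    by (simp add: add.commute)
qed

lemma GL_cocone_factors_through_GL_stable:
  fixes \<beta> :: "nat \<Rightarrow> 'a::{ring, monoid_mult} mat \<Rightarrow> 'h"
  assumes "GL_cocone H \<beta>"
  obtains h where "h \<in> hom GL_stable H"
    "\<And>n A. n \<ge> 3 \<Longrightarrow> A \<in> carrier (GL n) \<Longrightarrow> h (to_stable n A) = \<beta> n A"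
proof -
  \<comment> \<open>The choice ranges over values rather than representatives; on the carrier
    \<open>GL_cocone_to_stable_cong\<close> leaves exactly one candidate, and elsewhere the value is
    arbitrary.\<close>
  define h where "h f = (SOME x. \<exists>n\<ge>3. \<exists>A\<in>carrier (GL n). f = to_stable n A \<and> x = \<beta> n A)" for f
  have h: "h (to_stable n A) = \<beta> n A" if "n \<ge> 3" "A \<in> carrier (GL n)" for n A
    unfolding h_def
  proof (rule some_equality)
    show "\<exists>m\<ge>3. \<exists>B\<in>carrier (GL m). to_stable n A = to_stable m B \<and> \<beta> n A = \<beta> m B"
      using that by blast
    show "x = \<beta> n A"
      if "\<exists>m\<ge>3. \<exists>B\<in>carrier (GL m). to_stable n A = to_stable m B \<and> x = \<beta> m B" for x
      using that \<open>n \<ge> 3\<close> \<open>A \<in> carrier (GL n)\<close> by (metis GL_cocone_to_stable_cong[OF assms])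
  qed
  have "h \<in> hom GL_stable H"
  proof (rule homI)
    fix f :: "nat \<Rightarrow> nat \<Rightarrow> 'a" assume "f \<in> carrier GL_stable"
    then show "h f \<in> carrier H"
      using h hom_in_carrier[OF GL_coconeD(3)[OF assms]] by (fastforce simp: GL_stable_def)
  next
    fix f g :: "nat \<Rightarrow> nat \<Rightarrow> 'a" assume fg: "f \<in> carrier GL_stable" "g \<in> carrier GL_stable"
    obtain n A B where n: "n \<ge> 3" "A \<in> carrier (GL n)" "B \<in> carrier (GL n)"
      "f = to_stable n A" "g = to_stable n B"
      using GL_stable_representatives2[OF fg] .
    then show "h (f \<otimes>\<^bsub>GL_stable\<^esub> g) = h f \<otimes>\<^bsub>H\<^esub> h g"
      using hom_mult[OF GL_coconeD(3)[OF assms n(1)] n(2,3)]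
      by (simp add: to_stable_mult_GL h GL_mult_closed)
  qed
  then show thesis using that h by blast
qed

lemma GL_cocone_factors_through_K1:
  fixes \<beta> :: "nat \<Rightarrow> 'a::{ring, monoid_mult} mat \<Rightarrow> 'h"
  assumes "GL_cocone H \<beta>"
  obtains h where "h \<in> hom K1 H"
    "\<And>n A. n \<ge> 3 \<Longrightarrow> A \<in> carrier (GL n) \<Longrightarrow> h (to_K1 n A) = \<beta> n A"
proof -
  obtain g where g: "g \<in> hom GL_stable H"
    "\<And>n A. n \<ge> 3 \<Longrightarrow> A \<in> carrier (GL n) \<Longrightarrow> g (to_stable n A) = \<beta> n A"
    using GL_cocone_factors_through_GL_stable[OF assms] by blast
  interpret group_hom GL_stable H g
    by (simp add: group_hom_def group_hom_axioms_def group_GL_stable g(1) GL_coconeD(1)[OF assms])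
  have "E_stable \<subseteq> kernel GL_stable H g"
  proof
    fix e :: "nat \<Rightarrow> nat \<Rightarrow> 'a" assume "e \<in> E_stable"
    then obtain n A where n: "n \<ge> 3" "A \<in> E n" "e = to_stable n A"
      by (auto simp: E_stable_def)
    moreover have "A \<in> carrier (GL n)" using n E_subset_GL by blast
    ultimately show "e \<in> kernel GL_stable H g"
      by (simp add: kernel_def g(2) GL_cocone_E[OF assms] to_stable_in_GL_stable)
  qed
  then obtain h where h: "h \<in> hom (GL_stable Mod E_stable) H"
    "\<And>x. x \<in> carrier GL_stable \<Longrightarrow> h (E_stable #>\<^bsub>GL_stable\<^esub> x) = g x"
    using FactGroup_universal_kernel[OF E_stable_normal] by blast
  show thesis
  proof (rule that)
    show "h \<in> hom K1 H" using h(1) by (simp add: K1_def)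
    show "h (to_K1 n A) = \<beta> n A" if "n \<ge> 3" "A \<in> carrier (GL n)" for n A
      using that by (simp add: to_K1_def h(2) g(2) to_stable_in_GL_stable)
  qed
qed

section \<open>The universal property and the comparison isomorphism\<close>

lemma hom_restrict: "group G \<Longrightarrow> h \<in> hom G H \<Longrightarrow> restrict h (carrier G) \<in> hom G H"
  using group.is_monoid by (fastforce simp: hom_def monoid.m_closed)

text \<open>Uniqueness holds because every element of \<open>K1\<close> is of the form
  \<open>to_K1 n A\<close>, so the cocone fixes a homomorphism on the whole carrier.\<close>

lemma GL_colimit_K1:
  "GL_colimit TYPE('h) K1 (to_K1 :: nat \<Rightarrow> 'a::{ring, monoid_mult} mat \<Rightarrow> (nat \<Rightarrow> nat \<Rightarrow> 'a) set)"
  unfolding GL_colimit_def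
proof (intro conjI allI impI)
  show "GL_cocone K1 (to_K1 :: nat \<Rightarrow> 'a mat \<Rightarrow> _)" by (rule GL_cocone_K1)
  fix H :: "'h monoid" and \<beta> :: "nat \<Rightarrow> 'a mat \<Rightarrow> 'h"
  assume "GL_cocone H \<beta>"
  then obtain h where h: "h \<in> hom K1 H"
    "\<And>n A. n \<ge> 3 \<Longrightarrow> A \<in> carrier (GL n) \<Longrightarrow> h (to_K1 n A) = \<beta> n A"
    using GL_cocone_factors_through_K1 by blast
  have in_K1: "to_K1 n A \<in> carrier K1" if "n \<ge> 3" "A \<in> carrier (GL n)" for n and A :: "'a mat"
    using that by (auto simp: carrier_K1)
  show "\<exists>!h. h \<in> hom K1 H \<and> h \<in> extensional (carrier K1) \<and>
      (\<forall>n\<ge>3. \<forall>A\<in>carrier (GL n). h (to_K1 n A) = \<beta> n A)"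
  proof (rule ex1I[of _ "restrict h (carrier K1)"])
    show "restrict h (carrier K1) \<in> hom K1 H \<and> restrict h (carrier K1) \<in> extensional (carrier K1) \<and>
        (\<forall>n\<ge>3. \<forall>A\<in>carrier (GL n). restrict h (carrier K1) (to_K1 n A) = \<beta> n A)"
      using h in_K1 by (simp add: hom_restrict group_K1)
  next
    fix h'
    assume h': "h' \<in> hom K1 H \<and> h' \<in> extensional (carrier K1) \<and>
        (\<forall>n\<ge>3. \<forall>A\<in>carrier (GL n). h' (to_K1 n A) = \<beta> n A)"
    then show "h' = restrict h (carrier K1)"
      by (intro extensionalityI[where A = "carrier K1"]) (auto simp: carrier_K1 h)
  qed
qed

text \<open>The uniqueness clause of the colimit speaks of extensional maps; restricting
  \<open>f\<close> and \<open>g\<close> to the carrier transfers it to arbitrary representatives of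
  homomorphisms.\<close>

lemma GL_colimit_hom_unique:
  fixes M :: "'m monoid" and \<alpha> :: "nat \<Rightarrow> 'a::{ring, monoid_mult} mat \<Rightarrow> 'm" and H :: "'h monoid"
  assumes "GL_colimit TYPE('h) M \<alpha>" "GL_cocone H \<beta>"
    and "f \<in> hom M H" "\<And>n A. n \<ge> 3 \<Longrightarrow> A \<in> carrier (GL n) \<Longrightarrow> f (\<alpha> n A) = \<beta> n A"
    and "g \<in> hom M H" "\<And>n A. n \<ge> 3 \<Longrightarrow> A \<in> carrier (GL n) \<Longrightarrow> g (\<alpha> n A) = \<beta> n A"
    and "x \<in> carrier M"
  shows "f x = g x"
proof -
  have M: "GL_cocone M \<alpha>" using assms(1) by (simp add: GL_colimit_def)
  let ?P = "\<lambda>h. h \<in> hom M H \<and> h \<in> extensional (carrier M) \<and>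
      (\<forall>n\<ge>3. \<forall>A\<in>carrier (GL n). h (\<alpha> n A) = \<beta> n A)"
  have ex1: "\<exists>!h. ?P h" using assms(1,2) unfolding GL_colimit_def by blast
  have in_M: "\<alpha> n A \<in> carrier M" if "n \<ge> 3" "A \<in> carrier (GL n)" for n A
    using hom_in_carrier[OF GL_coconeD(3)[OF M]] that by blast
  have "?P (restrict f (carrier M))" "?P (restrict g (carrier M))"
    using assms(3-6) in_M by (simp_all add: hom_restrict GL_coconeD(1)[OF M])
  then have "restrict f (carrier M) = restrict g (carrier M)" using ex1 by blast
  then show ?thesis using assms(7) by (metis restrict_apply')
qed

text \<open>The universal property of \<open>M\<close> is tested against two types: that of
  \<open>K1\<close>, to obtain and characterize the map to \<open>K1\<close>, and that of
  \<open>M\<close> itself, to identify an endomorphism of \<open>M\<close> with the identity. The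
  last conjunct, with \<open>'h\<close> arbitrary, shows that \<open>K1\<close> is such a colimit,
  so the first is not vacuous.\<close>

theorem mainTheorem1:
  fixes M :: "'m monoid" and \<alpha> :: "nat \<Rightarrow> 'a::{ring, monoid_mult} mat \<Rightarrow> 'm"
  shows
    "(GL_colimit TYPE('m) M \<alpha> \<and> GL_colimit TYPE((nat \<Rightarrow> nat \<Rightarrow> 'a) set) M \<alpha> \<longrightarrow>
       (\<exists>\<phi>\<in>iso M K1.
          (\<forall>n\<ge>3. \<forall>A\<in>carrier (GL n). \<phi> (\<alpha> n A) = to_K1 n A) \<and>
          (\<forall>\<psi>\<in>hom M K1. (\<forall>n\<ge>3. \<forall>A\<in>carrier (GL n). \<psi> (\<alpha> n A) = to_K1 n A) \<longrightarrow>
             (\<forall>x\<in>carrier M. \<psi> x = \<phi> x)))) \<and>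
     GL_colimit TYPE('h) K1 (to_K1 :: nat \<Rightarrow> 'a mat \<Rightarrow> (nat \<Rightarrow> nat \<Rightarrow> 'a) set)"
proof (intro conjI impI GL_colimit_K1)
  assume "GL_colimit TYPE('m) M \<alpha> \<and> GL_colimit TYPE((nat \<Rightarrow> nat \<Rightarrow> 'a) set) M \<alpha>"
  then have colim: "GL_colimit TYPE('m) M \<alpha>" "GL_colimit TYPE((nat \<Rightarrow> nat \<Rightarrow> 'a) set) M \<alpha>"
    and cocone: "GL_cocone M \<alpha>"
    by (auto simp: GL_colimit_def)
  obtain \<phi> where \<phi>: "\<phi> \<in> hom M K1"
    "\<And>n A. n \<ge> 3 \<Longrightarrow> A \<in> carrier (GL n) \<Longrightarrow> \<phi> (\<alpha> n A) = to_K1 n A"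
    using colim(2) GL_cocone_K1 unfolding GL_colimit_def by blast
  \<comment> \<open>The candidate inverse comes from the factorization of the cocone
    \<open>\<alpha>\<close> through \<open>K1\<close>.\<close>
  obtain \<psi> where \<psi>: "\<psi> \<in> hom K1 M"
    "\<And>n A. n \<ge> 3 \<Longrightarrow> A \<in> carrier (GL n) \<Longrightarrow> \<psi> (to_K1 n A) = \<alpha> n A"
    using GL_cocone_factors_through_K1[OF cocone] by blast
  \<comment> \<open>Both endomorphisms are compatible with \<open>\<alpha>\<close>, so the universal
    property of \<open>M\<close> identifies them. The other composite is computed directly on the
    classes \<open>to_K1 n A\<close>, which exhaust \<open>K1\<close>.\<close>
  have "\<psi> \<circ> \<phi> \<in> hom M M" "id \<in> hom M M"
    using hom_compose[OF \<phi>(1) \<psi>(1)] by (auto simp: hom_def)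
  then have "\<psi> (\<phi> x) = x" if "x \<in> carrier M" for x
    using GL_colimit_hom_unique[OF colim(1) cocone, of "\<psi> \<circ> \<phi>" id x] that \<phi>(2) \<psi>(2)
    by simp
  moreover have "\<phi> (\<psi> y) = y" if "y \<in> carrier K1" for y
    using that \<phi>(2) \<psi>(2) by (auto simp: carrier_K1)
  ultimately have "bij_betw \<phi> (carrier M) (carrier K1)"
    using \<phi>(1) \<psi>(1) by (intro bij_betw_byWitness[of _ \<psi>]) (auto simp: hom_def)
  then have "\<phi> \<in> iso M K1" using \<phi>(1) by (simp add: iso_def)
  moreover have "\<phi>' x = \<phi> x"
    if "\<phi>' \<in> hom M K1" "\<forall>n\<ge>3. \<forall>A\<in>carrier (GL n). \<phi>' (\<alpha> n A) = to_K1 n A" "x \<in> carrier M"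
    for \<phi>' x
    using GL_colimit_hom_unique[OF colim(2) GL_cocone_K1 that(1) _ \<phi>(1) _ that(3)] that(2) \<phi>(2)
    by blast
  ultimately show "\<exists>\<phi>\<in>iso M K1.
      (\<forall>n\<ge>3. \<forall>A\<in>carrier (GL n). \<phi> (\<alpha> n A) = to_K1 n A) \<and>
      (\<forall>\<psi>\<in>hom M K1. (\<forall>n\<ge>3. \<forall>A\<in>carrier (GL n). \<psi> (\<alpha> n A) = to_K1 n A) \<longrightarrow>
         (\<forall>x\<in>carrier M. \<psi> x = \<phi> x))"
    using \<phi>(2) by (intro bexI[of _ \<phi>] conjI allI ballI impI) simp_all
qed

end
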